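(* An instance $\pi$ of the fluid mixing problem is solvable if and only if it satisfies the fractional slack condition, i.e. $\mathrm{slack}_l(\pi)\ge0$ for all $1\le l\le k-1$.
   Context: An instance of the fluid mixing problem with $n$ source and $k$ target containers is $\pi=(\bar a,\bar u,\bar b,\bar v)$ with $\bar a\in\mathbb R_{\ge0}^n$, $\bar u\in\mathbb R_{>0}^n$, $\bar b\in\mathbb R_{\ge0}^k$, $\bar v\in\mathbb R_{>0}^k$ (except that $u_1=a_1=0$ and/or $v_1=b_1=0$ are allowed), satisfying $\sum_{i=1}^na_i=\sum_{j=1}^kb_j$ and $\sum_{i=1}^nu_i=\sum_{j=1}^kv_j$, and ordered by density: $a_1/u_1\ge\cdots\ge a_n/u_n$ and $b_1/v_1\ge\cdots\ge b_k/v_k$. It is solvable if there is $X=(x_{i,j})_{i\in[n],j\in[k]}$ with $x_{i,j}\ge0$, $\sum_{j=1}^kx_{i,j}=1$ for all $i$, $\sum_{i=1}^nu_ix_{i,j}=v_j$ and $\sum_{i=1}^na_ix_{i,j}=b_j$ for all $j$. Let $U_0=V_0=0$, $U_i=\sum_{i'\le i}u_{i'}$, $V_l=\sum_{j\le l}v_j$, $\mu_{i,l}=\max(0,\min(u_i,V_l-U_{i-1}))$, and $\mathrm{slack}_l(\pi)=\sum_{i=1}^n\frac{a_i}{u_i}\mu_{i,l}-\sum_{j=1}^lb_j$, where a summand with $u_i=0$ is taken to be $0$. *)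

theory Defs
  imports Complex_Main
begin

text \<open>Vectors of length \<open>n\<close> are functions on \<open>nat\<close> of which only the values at the indices \<open>1, \<dots>, n\<close>
  are used. The sources are \<open>(a, u)\<close> with \<open>n\<close> containers, the targets \<open>(b, v)\<close> with \<open>k\<close> containers.\<close>

text \<open>Only the first container may be empty. Its density is then undefined, and the comparison with
  the second container is dropped: \<open>0 / 0 = 0\<close> in HOL would instead force all later amounts to
  vanish.\<close>

definition containers :: "nat \<Rightarrow> (nat \<Rightarrow> real) \<Rightarrow> (nat \<Rightarrow> real) \<Rightarrow> bool" where
  "containers n a u \<longleftrightarrow>
     (\<forall>i\<in>{1..n}. 0 \<le> a i \<and> (0 < u i \<or> i = 1 \<and> u i = 0 \<and> a i = 0)) \<and>
     (\<forall>i\<in>{1..<n}. u i \<noteq> 0 \<longrightarrow> a i / u i \<ge> a (i + 1) / u (i + 1))"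

definition mixing_instance ::
  "nat \<Rightarrow> nat \<Rightarrow> (nat \<Rightarrow> real) \<Rightarrow> (nat \<Rightarrow> real) \<Rightarrow> (nat \<Rightarrow> real) \<Rightarrow> (nat \<Rightarrow> real) \<Rightarrow> bool" where
  "mixing_instance n k a u b v \<longleftrightarrow>
     1 \<le> n \<and> 1 \<le> k \<and> containers n a u \<and> containers k b v \<and>
     (\<Sum>i=1..n. a i) = (\<Sum>j=1..k. b j) \<and>
     (\<Sum>i=1..n. u i) = (\<Sum>j=1..k. v j)"

definition mixing_solvable ::
  "nat \<Rightarrow> nat \<Rightarrow> (nat \<Rightarrow> real) \<Rightarrow> (nat \<Rightarrow> real) \<Rightarrow> (nat \<Rightarrow> real) \<Rightarrow> (nat \<Rightarrow> real) \<Rightarrow> bool" where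
  "mixing_solvable n k a u b v \<longleftrightarrow>
     (\<exists>x :: nat \<Rightarrow> nat \<Rightarrow> real.
        (\<forall>i\<in>{1..n}. \<forall>j\<in>{1..k}. 0 \<le> x i j) \<and>
        (\<forall>i\<in>{1..n}. (\<Sum>j=1..k. x i j) = 1) \<and>
        (\<forall>j\<in>{1..k}. (\<Sum>i=1..n. u i * x i j) = v j) \<and>
        (\<forall>j\<in>{1..k}. (\<Sum>i=1..n. a i * x i j) = b j))"

definition cumulative :: "(nat \<Rightarrow> real) \<Rightarrow> nat \<Rightarrow> real" where
  "cumulative w l = (\<Sum>i=1..l. w i)"

definition frac_mu :: "(nat \<Rightarrow> real) \<Rightarrow> (nat \<Rightarrow> real) \<Rightarrow> nat \<Rightarrow> nat \<Rightarrow> real" where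
  "frac_mu u v i l = max 0 (min (u i) (cumulative v l - cumulative u (i - 1)))"

text \<open>A summand with \<open>u i = 0\<close> is \<open>0\<close>, since \<open>a i / 0 = 0\<close> in HOL.\<close>

definition slack ::
  "nat \<Rightarrow> (nat \<Rightarrow> real) \<Rightarrow> (nat \<Rightarrow> real) \<Rightarrow> (nat \<Rightarrow> real) \<Rightarrow> (nat \<Rightarrow> real) \<Rightarrow> nat \<Rightarrow> real" where
  "slack n a u b v l = (\<Sum>i=1..n. a i / u i * frac_mu u v i l) - (\<Sum>j=1..l. b j)"

definition fractional_slack_condition ::
  "nat \<Rightarrow> nat \<Rightarrow> (nat \<Rightarrow> real) \<Rightarrow> (nat \<Rightarrow> real) \<Rightarrow> (nat \<Rightarrow> real) \<Rightarrow> (nat \<Rightarrow> real) \<Rightarrow> bool" where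
  "fractional_slack_condition n k a u b v \<longleftrightarrow> (\<forall>l\<in>{1..k - 1}. slack n a u b v l \<ge> 0)"

end

theory Submission
  imports Defs
begin

text \<open>Write \<open>\<alpha>\<close>, \<open>\<beta>\<close> for the densities of sources and targets. Necessity is an exchange
  argument: among all ways of drawing the volume \<open>V\<^sub>l\<close> from the sources, taking the densest fluid
  first contains the most solute, and \<open>slack\<^sub>l\<close> compares this maximum with the demand.

  For sufficiency, the slack condition says that the sources dominate the targets in the convex
  order: \<open>\<Sum>j. v\<^sub>j max 0 (\<beta>\<^sub>j - t) \<le> \<Sum>i. u\<^sub>i max 0 (\<alpha>\<^sub>i - t)\<close> for every \<open>t\<close>. Pick a nonempty target
  \<open>j\<close> and the nonempty sources of densities \<open>A \<le> \<beta>\<^sub>j \<le> B\<close> closest to \<open>\<beta>\<^sub>j\<close>, and pour a mixture of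
  these two of density \<open>\<beta>\<^sub>j\<close> until a container is exhausted. Both sides of the inequality lose the
  same amount for \<open>t\<close> outside \<open>(A, B)\<close>. On \<open>[A, B]\<close> the source side is affine, as no remaining source
  lies strictly between, and the target side is convex, so the inequality at the end points gives it
  in between. The convex order is thus preserved, and one inducts on the number of nonempty
  containers.\<close>

section \<open>Potentials of weighted point masses\<close>

text \<open>This is the call function (stop-loss transform) of the measure with mass
  \<open>w i\<close> at \<open>f i\<close>. For equal total mass and equal mean, pointwise
  comparison of potentials is the convex order.\<close>

definition potential :: "'i set \<Rightarrow> ('i \<Rightarrow> real) \<Rightarrow> ('i \<Rightarrow> real) \<Rightarrow> real \<Rightarrow> real" where
  "potential I w f t = (\<Sum>i\<in>I. w i * max 0 (f i - t))"

lemma potential_nonneg: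
  assumes "\<And>i. i \<in> I \<Longrightarrow> 0 \<le> w i"
  shows "0 \<le> potential I w f t"
  unfolding potential_def using assms by (intro sum_nonneg) auto

lemma potential_ge_summand:
  assumes "finite I" "\<And>i. i \<in> I \<Longrightarrow> 0 \<le> w i" "j \<in> I"
  shows "w j * max 0 (f j - t) \<le> potential I w f t"
  unfolding potential_def using assms
  by (intro member_le_sum[where f = "\<lambda>i. w i * max 0 (f i - t)"]) auto

lemma potential_diff:
  "potential I (\<lambda>i. w i - c * d i) f t = potential I w f t - c * potential I d f t"
  by (simp add: potential_def algebra_simps sum_subtractf sum_distrib_left)

text \<open>Follows from \<open>max 0 (t - f) = max 0 (f - t) - f + t\<close>. When masses and means
  agree, an inequality of potentials therefore also holds for the mirrored functions, which detect
  mass below a threshold.\<close>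

lemma potential_reflect:
  "(\<Sum>i\<in>I. w i * max 0 (t - f i)) = potential I w f t - (\<Sum>i\<in>I. w i * f i) + t * (\<Sum>i\<in>I. w i)"
proof -
  have "w i * max 0 (t - f i) = w i * max 0 (f i - t) - w i * f i + t * w i" for i
    by (auto simp: max_def algebra_simps)
  then show ?thesis
    by (simp add: potential_def sum.distrib sum_subtractf sum_distrib_left)
qed

lemma potential_convex:
  assumes "\<And>i. i \<in> I \<Longrightarrow> 0 \<le> w i" "0 \<le> s" "s \<le> 1"
  shows "potential I w f (s * A + (1 - s) * B)
    \<le> s * potential I w f A + (1 - s) * potential I w f B"
proof -
  have "w i * max 0 (f i - (s * A + (1 - s) * B))
      \<le> s * (w i * max 0 (f i - A)) + (1 - s) * (w i * max 0 (f i - B))" if "i \<in> I" for i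
  proof -
    have "s * (f i - A) \<le> s * max 0 (f i - A)" "(1 - s) * (f i - B) \<le> (1 - s) * max 0 (f i - B)"
      using assms by (auto intro!: mult_left_mono)
    moreover have "0 \<le> s * max 0 (f i - A)" "0 \<le> (1 - s) * max 0 (f i - B)"
      using assms by auto
    moreover have "f i - (s * A + (1 - s) * B) = s * (f i - A) + (1 - s) * (f i - B)"
      by (simp add: algebra_simps)
    ultimately have "max 0 (f i - (s * A + (1 - s) * B))
        \<le> s * max 0 (f i - A) + (1 - s) * max 0 (f i - B)"
      by (intro max.boundedI) linarith+
    then have "w i * max 0 (f i - (s * A + (1 - s) * B))
        \<le> w i * (s * max 0 (f i - A) + (1 - s) * max 0 (f i - B))"
      using assms(1)[OF that] by (rule mult_left_mono)
    then show ?thesis by (simp add: algebra_simps)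
  qed
  then show ?thesis
    unfolding potential_def sum_distrib_left sum.distrib[symmetric] by (rule sum_mono)
qed

text \<open>As a function of the threshold, each summand has its only kink at \<open>f i\<close>,
  and no kink of nonzero weight lies strictly between \<open>A\<close> and \<open>B\<close>.\<close>

lemma potential_affine:
  assumes "\<And>i. i \<in> I \<Longrightarrow> w i = 0 \<or> f i \<le> A \<or> B \<le> f i" "A \<le> B" "0 \<le> s" "s \<le> 1"
  shows "potential I w f (s * A + (1 - s) * B)
    = s * potential I w f A + (1 - s) * potential I w f B"
proof -
  have mid: "A \<le> s * A + (1 - s) * B" "s * A + (1 - s) * B \<le> B"
    using mult_left_mono[OF assms(2), of "1 - s"] mult_left_mono[OF assms(2,3)] assms(4)
    by (auto simp: algebra_simps)
  have "w i * max 0 (f i - (s * A + (1 - s) * B))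
      = s * (w i * max 0 (f i - A)) + (1 - s) * (w i * max 0 (f i - B))" if "i \<in> I" for i
  proof -
    note cases = assms(1)[OF that]
    consider "w i = 0" | "f i \<le> A" | "B \<le> f i" using cases by blast
    then show ?thesis
    proof cases
      case 2
      then show ?thesis using mid assms(2) by simp
    next
      case 3
      then have "max 0 (f i - (s * A + (1 - s) * B)) = f i - (s * A + (1 - s) * B)"
        "max 0 (f i - A) = f i - A" "max 0 (f i - B) = f i - B"
        using mid assms(2) by auto
      then show ?thesis by (simp add: algebra_simps)
    qed simp
  qed
  then show ?thesis
    unfolding potential_def sum_distrib_left sum.distrib[symmetric] by (rule sum.cong[OF refl])
qed

section \<open>Pouring a mixture of two neighbouring densities\<close>

text \<open>\<open>A\<close> is the largest density of a nonempty source that is at most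
  \<open>\<beta>\<close>, and \<open>B\<close> the smallest that is at least \<open>\<beta>\<close>.
  The proportions \<open>d\<close> come from the lever rule, and extremality leaves no nonempty
  source strictly in between.\<close>

lemma neighbouring_mixture:
  fixes u \<alpha> :: "'i \<Rightarrow> real"
  assumes fin: "finite I"
    and lo: "\<exists>i\<in>I. 0 < u i \<and> \<alpha> i \<le> \<beta>" and hi: "\<exists>i\<in>I. 0 < u i \<and> \<beta> \<le> \<alpha> i"
  obtains A B d where "A \<le> \<beta>" "\<beta> \<le> B"
    "\<And>i. i \<in> I \<Longrightarrow> 0 \<le> d i"
    "\<And>i. i \<in> I \<Longrightarrow> d i \<noteq> 0 \<Longrightarrow> 0 < u i \<and> (\<alpha> i = A \<or> \<alpha> i = B)"
    "(\<Sum>i\<in>I. d i) = 1" "(\<Sum>i\<in>I. d i * \<alpha> i) = \<beta>"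
    "\<And>i. i \<in> I \<Longrightarrow> 0 < u i \<Longrightarrow> \<alpha> i \<le> A \<or> B \<le> \<alpha> i"
proof -
  define L where "L = {i\<in>I. 0 < u i \<and> \<alpha> i \<le> \<beta>}"
  define H where "H = {i\<in>I. 0 < u i \<and> \<beta> \<le> \<alpha> i}"
  have LH: "finite L" "finite H" "L \<noteq> {}" "H \<noteq> {}"
    using assms by (auto simp: L_def H_def)
  have "Max (\<alpha> ` L) \<in> \<alpha> ` L" "Min (\<alpha> ` H) \<in> \<alpha> ` H" using LH by auto
  then obtain p q where p: "p \<in> L" "\<alpha> p = Max (\<alpha> ` L)" and q: "q \<in> H" "\<alpha> q = Min (\<alpha> ` H)"
    by auto
  have pL: "\<alpha> i \<le> \<alpha> p" if "i \<in> L" for i using that LH p by auto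
  have qH: "\<alpha> q \<le> \<alpha> i" if "i \<in> H" for i using that LH q by auto
  have pI: "p \<in> I" "0 < u p" "\<alpha> p \<le> \<beta>" and qI: "q \<in> I" "0 < u q" "\<beta> \<le> \<alpha> q"
    using p q by (auto simp: L_def H_def)
  \<comment> \<open>If \<open>\<alpha> p = \<alpha> q\<close> then \<open>r = 0\<close> by the convention \<open>x / 0 = 0\<close>, and only \<open>q\<close> is used.\<close>
  define r where "r = (\<alpha> q - \<beta>) / (\<alpha> q - \<alpha> p)"
  have r: "0 \<le> r" "r \<le> 1" using pI qI by (auto simp: r_def divide_le_eq)
  have r\<beta>: "r * \<alpha> p + (1 - r) * \<alpha> q = \<beta>"
  proof (cases "\<alpha> p = \<alpha> q")
    case True
    then show ?thesis using pI qI by (simp add: r_def)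
  next
    case False
    then have "r * (\<alpha> q - \<alpha> p) = \<alpha> q - \<beta>" by (simp add: r_def)
    then show ?thesis by (simp add: algebra_simps)
  qed
  \<comment> \<open>Adding two indicator terms, rather than nesting the cases, keeps the total
    weight 1 also when \<open>p = q\<close>.\<close>
  define d where "d = (\<lambda>i. (if i = p then r else 0) + (if i = q then 1 - r else 0))"
  have "(\<Sum>i\<in>I. d i) = 1"
    using fin pI qI by (simp add: d_def sum.distrib)
  moreover have "(\<Sum>i\<in>I. d i * \<alpha> i) = \<beta>"
    using fin pI qI r\<beta> by (simp add: d_def sum.distrib distrib_right if_distrib[of "\<lambda>x. x * _"] cong: if_cong)
  moreover have "0 \<le> d i" for i
    using r by (simp add: d_def)
  moreover have "0 < u i \<and> (\<alpha> i = \<alpha> p \<or> \<alpha> i = \<alpha> q)" if "d i \<noteq> 0" for i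
    using that pI qI by (auto simp: d_def split: if_splits)
  moreover have "\<alpha> i \<le> \<alpha> p \<or> \<alpha> q \<le> \<alpha> i" if "i \<in> I" "0 < u i" for i
    using that pL[of i] qH[of i] by (cases "\<alpha> i \<le> \<beta>") (auto simp: L_def H_def)
  ultimately show ?thesis
    using pI qI by (intro that[of "\<alpha> p" "\<alpha> q" d])
qed

text \<open>For \<open>t\<close> outside the open interval, the positive part is affine on
  \<open>[A, B]\<close>, so it commutes with averaging over the mixture.\<close>

lemma potential_mixture:
  assumes "\<And>i. i \<in> I \<Longrightarrow> 0 \<le> d i" "(\<Sum>i\<in>I. d i) = 1" "(\<Sum>i\<in>I. d i * \<alpha> i) = \<beta>"
    and AB: "\<And>i. i \<in> I \<Longrightarrow> d i \<noteq> 0 \<Longrightarrow> \<alpha> i = A \<or> \<alpha> i = B"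
    and "A \<le> \<beta>" "\<beta> \<le> B" "t \<le> A \<or> B \<le> t"
  shows "potential I d \<alpha> t = max 0 (\<beta> - t)"
proof (cases "t \<le> A")
  case True
  have "potential I d \<alpha> t = (\<Sum>i\<in>I. d i * \<alpha> i - d i * t)"
    unfolding potential_def
  proof (rule sum.cong[OF refl])
    fix i assume "i \<in> I"
    show "d i * max 0 (\<alpha> i - t) = d i * \<alpha> i - d i * t"
      using AB[OF \<open>i \<in> I\<close>] True assms(5,6) by (cases "d i = 0") (auto simp: algebra_simps)
  qed
  also have "\<dots> = \<beta> - t"
    using assms(2,3) by (simp add: sum_subtractf flip: sum_distrib_right)
  finally show ?thesis using True assms(5) by simp
next
  case False
  have "potential I d \<alpha> t = 0"
    unfolding potential_def
  proof (intro sum.neutral ballI)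
    fix i assume "i \<in> I"
    show "d i * max 0 (\<alpha> i - t) = 0"
      using AB[OF \<open>i \<in> I\<close>] False assms(5-7) by (cases "d i = 0") auto
  qed
  then show ?thesis using False assms(5-7) by simp
qed

text \<open>A ratio test: \<open>w\<close> is the minimum of \<open>v\<close> and all quotients
  \<open>u i / d i\<close> with \<open>d i \<noteq> 0\<close>, and whichever attains it names the
  exhausted container.\<close>

lemma max_multiple_below:
  fixes u d :: "'i \<Rightarrow> real"
  assumes fin: "finite I" and d: "\<And>i. i \<in> I \<Longrightarrow> 0 \<le> d i" "\<And>i. i \<in> I \<Longrightarrow> d i \<noteq> 0 \<Longrightarrow> 0 < u i"
    and u: "\<And>i. i \<in> I \<Longrightarrow> 0 \<le> u i" and "0 < v"
  obtains w where "0 < w" "w \<le> v" "\<And>i. i \<in> I \<Longrightarrow> w * d i \<le> u i"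
    "w = v \<or> (\<exists>i\<in>I. 0 < u i \<and> u i = w * d i)"
proof -
  define M where "M = insert v ((\<lambda>i. u i / d i) ` {i\<in>I. d i \<noteq> 0})"
  have M: "finite M" "M \<noteq> {}" using fin by (auto simp: M_def)
  have pos: "0 < d i" "0 < u i" if "i \<in> I" "d i \<noteq> 0" for i using d that by force+
  have "0 < m" if "m \<in> M" for m using that pos \<open>0 < v\<close> by (auto simp: M_def)
  then have "0 < Min M" using M by simp
  moreover have "Min M \<le> v" using M by (simp add: M_def)
  moreover have "Min M * d i \<le> u i" if "i \<in> I" for i
  proof (cases "d i = 0")
    case False
    then have "Min M \<le> u i / d i" using M that by (intro Min_le) (auto simp: M_def)
    then show ?thesis using pos[OF that False] by (simp add: pos_le_divide_eq)
  qed (use u that in simp)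
  moreover have "Min M = v \<or> (\<exists>i\<in>I. 0 < u i \<and> u i = Min M * d i)"
  proof -
    have "Min M \<in> M" using M by (rule Min_in)
    then consider "Min M = v" | i where "i \<in> I" "d i \<noteq> 0" "Min M = u i / d i"
      unfolding M_def by blast
    then show ?thesis by cases (auto intro!: pos)
  qed
  ultimately show ?thesis by (rule that)
qed

section \<open>Transport between discrete measures in convex order\<close>

text \<open>A discrete form of Strassen's theorem: \<open>y\<close> is a coupling in which the fluid
  reaching \<open>j\<close> has mean density \<open>\<beta> j\<close>. Exhausted containers stay in
  the index sets with volume 0; the induction varies only \<open>u\<close> and \<open>v\<close> and
  counts the positive volumes.\<close>

theorem convex_order_transport:
  fixes u \<alpha> :: "'i \<Rightarrow> real" and v \<beta> :: "'j \<Rightarrow> real"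
  assumes "finite I" "finite J"
    and "\<And>i. i \<in> I \<Longrightarrow> 0 \<le> u i" "\<And>j. j \<in> J \<Longrightarrow> 0 \<le> v j"
    and "(\<Sum>i\<in>I. u i) = (\<Sum>j\<in>J. v j)"
    and "(\<Sum>i\<in>I. u i * \<alpha> i) = (\<Sum>j\<in>J. v j * \<beta> j)"
    and "\<And>t. potential J v \<beta> t \<le> potential I u \<alpha> t"
  shows "\<exists>y. (\<forall>i\<in>I. \<forall>j\<in>J. 0 \<le> y i j) \<and> (\<forall>i\<in>I. (\<Sum>j\<in>J. y i j) = u i) \<and>
    (\<forall>j\<in>J. (\<Sum>i\<in>I. y i j) = v j) \<and> (\<forall>j\<in>J. (\<Sum>i\<in>I. y i j * \<alpha> i) = v j * \<beta> j)"
  using assms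
proof (induction "card {i\<in>I. 0 < u i} + card {j\<in>J. 0 < v j}" arbitrary: u v rule: less_induct)
  case less
  note fin = less.prems(1,2) and u = less.prems(3) and v = less.prems(4)
    and vol = less.prems(5) and mass = less.prems(6) and ord = less.prems(7)
  show ?case
  proof (cases "\<exists>j\<in>J. 0 < v j")
    case False
    then have v0: "v j = 0" if "j \<in> J" for j using v that by force
    then have "(\<Sum>i\<in>I. u i) = 0" using vol by simp
    then have "u i = 0" if "i \<in> I" for i using u fin that by (simp add: sum_nonneg_eq_0_iff)
    then show ?thesis using v0 by (intro exI[of _ "\<lambda>_ _. 0"]) simp
  next
    case True
    then obtain j where j: "j \<in> J" "0 < v j" by blast
    have above: "\<exists>i\<in>I. 0 < u i \<and> \<beta> j \<le> \<alpha> i"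
    proof (rule ccontr)
      assume neg: "\<not> ?thesis"
      \<comment> \<open>\<open>Max S\<close> is a threshold below \<open>\<beta> j\<close> but not
        below any nonempty source. There the source potential vanishes, while target
        \<open>j\<close> contributes a positive amount. The inserted element keeps \<open>S\<close>
        nonempty.\<close>
      define S where "S = insert (\<beta> j - 1) (\<alpha> ` {i\<in>I. 0 < u i})"
      have S: "finite S" using fin by (simp add: S_def)
      have "potential I u \<alpha> (Max S) = 0"
        unfolding potential_def
      proof (intro sum.neutral ballI)
        fix i assume "i \<in> I"
        then show "u i * max 0 (\<alpha> i - Max S) = 0"
          using u[of i] S Max_ge[of S "\<alpha> i"] by (cases "u i = 0") (auto simp: S_def)
      qed
      moreover have "Max S < \<beta> j" using S neg by (subst Max_less_iff) (auto simp: S_def)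
      then have "0 < v j * max 0 (\<beta> j - Max S)" using j by simp
      ultimately show False
        using ord[of "Max S"] potential_ge_summand[OF fin(2) _ j(1), of v \<beta> "Max S"] v
        by force
    qed
    have below: "\<exists>i\<in>I. 0 < u i \<and> \<alpha> i \<le> \<beta> j"
    proof (rule ccontr)
      assume neg: "\<not> ?thesis"
      \<comment> \<open>The mirror image: the threshold \<open>Min S\<close> lies above
        \<open>\<beta> j\<close> but not above any nonempty source, and the reflected potentials are
        compared.\<close>
      define S where "S = insert (\<beta> j + 1) (\<alpha> ` {i\<in>I. 0 < u i})"
      have S: "finite S" using fin by (simp add: S_def)
      have "(\<Sum>i\<in>I. u i * max 0 (Min S - \<alpha> i)) = 0"
      proof (intro sum.neutral ballI)
        fix i assume "i \<in> I"
        then show "u i * max 0 (Min S - \<alpha> i) = 0"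
          using u[of i] S Min_le[of S "\<alpha> i"] by (cases "u i = 0") (auto simp: S_def)
      qed
      then have "(\<Sum>j\<in>J. v j * max 0 (Min S - \<beta> j)) \<le> 0"
        using ord[of "Min S"] vol mass by (simp add: potential_reflect)
      moreover have "v j * max 0 (Min S - \<beta> j) \<le> (\<Sum>j\<in>J. v j * max 0 (Min S - \<beta> j))"
        using fin j v by (intro member_le_sum[where f = "\<lambda>j. v j * max 0 (Min S - \<beta> j)"]) auto
      moreover have "\<beta> j < Min S" using S neg by (subst Min_gr_iff) (auto simp: S_def)
      then have "0 < v j * max 0 (Min S - \<beta> j)" using j by simp
      ultimately show False by linarith
    qed
    obtain A B d where AB: "A \<le> \<beta> j" "\<beta> j \<le> B"
      and d: "\<And>i. i \<in> I \<Longrightarrow> 0 \<le> d i"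
        "\<And>i. i \<in> I \<Longrightarrow> d i \<noteq> 0 \<Longrightarrow> 0 < u i \<and> (\<alpha> i = A \<or> \<alpha> i = B)"
        "(\<Sum>i\<in>I. d i) = 1" "(\<Sum>i\<in>I. d i * \<alpha> i) = \<beta> j"
      and gap: "\<And>i. i \<in> I \<Longrightarrow> 0 < u i \<Longrightarrow> \<alpha> i \<le> A \<or> B \<le> \<alpha> i"
      by (rule neighbouring_mixture[OF fin(1) below above]) (rule that)
    have d_pos: "0 < u i" if "i \<in> I" "d i \<noteq> 0" for i using d(2)[OF that] by simp
    obtain w where w: "0 < w" "w \<le> v j" "\<And>i. i \<in> I \<Longrightarrow> w * d i \<le> u i"
      and exhausted: "w = v j \<or> (\<exists>i\<in>I. 0 < u i \<and> u i = w * d i)"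
      by (rule max_multiple_below[of I d u "v j", OF fin(1) d(1) d_pos u j(2)]) (auto intro: that)
    \<comment> \<open>The unit mass at target \<open>j\<close>. With it the removal from the targets
      has the same shape as the removal of \<open>w * d i\<close> from the sources, so
      \<open>potential_diff\<close> covers both.\<close>
    define e where "e = (\<lambda>j'. if j' = j then 1 else 0 :: real)"
    define u' where "u' = (\<lambda>i. u i - w * d i)"
    define v' where "v' = (\<lambda>j. v j - w * e j)"
    have e: "(\<Sum>j\<in>J. e j) = 1" "(\<Sum>j\<in>J. e j * \<beta> j) = \<beta> j"
      "potential J e \<beta> t = max 0 (\<beta> j - t)" for t
      using fin j by (simp_all add: e_def potential_def if_distrib[of "\<lambda>x. x * _"] cong: if_cong)
    have u': "0 \<le> u' i" if "i \<in> I" for i using w that by (simp add: u'_def)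
    have v': "0 \<le> v' j'" if "j' \<in> J" for j' using w v that by (simp add: v'_def e_def)
    have "{i\<in>I. 0 < u' i} \<subseteq> {i\<in>I. 0 < u i}"
      using w d(1) by (auto simp: u'_def) (smt (verit) mult_nonneg_nonneg)
    moreover have "{j\<in>J. 0 < v' j} \<subseteq> {j\<in>J. 0 < v j}"
      using w by (auto simp: v'_def e_def split: if_splits)
    moreover have "{i\<in>I. 0 < u' i} \<noteq> {i\<in>I. 0 < u i} \<or> {j\<in>J. 0 < v' j} \<noteq> {j\<in>J. 0 < v j}"
    proof (cases "w = v j")
      case True
      then have "j \<in> {j\<in>J. 0 < v j}" "j \<notin> {j\<in>J. 0 < v' j}" using j by (auto simp: v'_def e_def)
      then show ?thesis by blast
    next
      case False
      then obtain i where "i \<in> I" "0 < u i" "u i = w * d i" using exhausted by blast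
      then have "i \<in> {i\<in>I. 0 < u i}" "i \<notin> {i\<in>I. 0 < u' i}" by (auto simp: u'_def)
      then show ?thesis by blast
    qed
    moreover have "finite {i\<in>I. 0 < u i}" "finite {j\<in>J. 0 < v j}" using fin by auto
    ultimately have smaller: "card {i\<in>I. 0 < u' i} + card {j\<in>J. 0 < v' j}
        < card {i\<in>I. 0 < u i} + card {j\<in>J. 0 < v j}"
      by (meson add_le_less_mono add_less_le_mono card_mono psubset_card_mono psubsetI)
    have vol': "(\<Sum>i\<in>I. u' i) = (\<Sum>j\<in>J. v' j)"
      using vol d e by (simp add: u'_def v'_def sum_subtractf flip: sum_distrib_left)
    have mass': "(\<Sum>i\<in>I. u' i * \<alpha> i) = (\<Sum>j\<in>J. v' j * \<beta> j)"
      using mass d e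
      by (simp add: u'_def v'_def sum_subtractf left_diff_distrib mult.assoc flip: sum_distrib_left)
    have outside: "potential J v' \<beta> t \<le> potential I u' \<alpha> t" if "t \<le> A \<or> B \<le> t" for t
      using ord[of t] potential_mixture[of I d \<alpha> "\<beta> j" A B t] d AB that e(3)[of t]
      by (simp add: u'_def v'_def potential_diff)
    have ord': "potential J v' \<beta> t \<le> potential I u' \<alpha> t" for t
    proof (cases "t \<le> A \<or> B \<le> t")
      case False
      \<comment> \<open>The barycentric coordinate of \<open>t\<close> in \<open>[A, B]\<close>; the
        case assumption gives \<open>A < t < B\<close>, so the denominator is positive.\<close>
      define s where "s = (B - t) / (B - A)"
      have s: "0 \<le> s" "s \<le> 1" using False by (auto simp: s_def divide_le_eq)
      have "s * (B - A) = B - t" using False by (simp add: s_def)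
      then have t: "t = s * A + (1 - s) * B" by (simp add: algebra_simps)
      \<comment> \<open>A source with \<open>u i = 0\<close> has \<open>d i = 0\<close>, so it is
        still empty after pouring.\<close>
      have "u' i = 0 \<or> \<alpha> i \<le> A \<or> B \<le> \<alpha> i" if "i \<in> I" for i
        using gap[OF that] u[OF that] d(2)[OF that] by (cases "u i = 0") (auto simp: u'_def)
      then have "potential I u' \<alpha> t = s * potential I u' \<alpha> A + (1 - s) * potential I u' \<alpha> B"
        unfolding t using AB s by (intro potential_affine) auto
      moreover have "potential J v' \<beta> t \<le> s * potential J v' \<beta> A + (1 - s) * potential J v' \<beta> B"
        unfolding t using v' s by (intro potential_convex) auto
      moreover have "s * potential J v' \<beta> A \<le> s * potential I u' \<alpha> A"
        "(1 - s) * potential J v' \<beta> B \<le> (1 - s) * potential I u' \<alpha> B"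
        using outside[of A] outside[of B] s by (auto intro!: mult_left_mono)
      ultimately show ?thesis by linarith
    qed (rule outside)
    obtain y where y: "\<forall>i\<in>I. \<forall>j\<in>J. 0 \<le> y i j" "\<forall>i\<in>I. (\<Sum>j\<in>J. y i j) = u' i"
      "\<forall>j\<in>J. (\<Sum>i\<in>I. y i j) = v' j" "\<forall>j\<in>J. (\<Sum>i\<in>I. y i j * \<alpha> i) = v' j * \<beta> j"
      using less.hyps[OF smaller fin u' v' vol' mass' ord'] by blast
    \<comment> \<open>The plan for the remaining volumes, plus the mixture just poured into
      \<open>j\<close>.\<close>
    define z where "z = (\<lambda>i j. y i j + w * d i * e j)"
    have "0 \<le> z i j'" if "i \<in> I" "j' \<in> J" for i j'
      using y(1) d(1) w that by (simp add: z_def e_def)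
    moreover have "(\<Sum>j\<in>J. z i j) = u i" if "i \<in> I" for i
      using y(2) that e(1) by (simp add: z_def sum.distrib u'_def flip: sum_distrib_left)
    moreover have "(\<Sum>i\<in>I. z i j') = v j'" if "j' \<in> J" for j'
      using y(3) that d(3)
      by (simp add: z_def sum.distrib v'_def flip: sum_distrib_left sum_distrib_right)
    moreover have "(\<Sum>i\<in>I. z i j' * \<alpha> i) = v j' * \<beta> j'" if "j' \<in> J" for j'
    proof -
      have "(\<Sum>i\<in>I. z i j' * \<alpha> i) = (\<Sum>i\<in>I. y i j' * \<alpha> i) + w * e j' * (\<Sum>i\<in>I. d i * \<alpha> i)"
        by (simp add: z_def sum.distrib sum_distrib_left algebra_simps)
      then show ?thesis
        using bspec[OF y(4) that] d(4)
        by (cases "j' = j") (simp_all add: v'_def e_def algebra_simps)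
    qed
    ultimately show ?thesis by (intro exI[of _ z]) blast
  qed
qed

section \<open>Containers and greedy draining of the sources\<close>

lemma containers_D:
  assumes "containers n a u" "i \<in> {1..n}"
  shows "0 \<le> a i" "0 < u i \<or> i = 1 \<and> u i = 0 \<and> a i = 0"
  using assms unfolding containers_def by blast+

lemma containers_nonneg:
  assumes "containers n a u" "i \<in> {1..n}"
  shows "0 \<le> u i" "0 \<le> a i"
  using containers_D[OF assms] by auto

text \<open>Also valid for an empty container, because then \<open>a i = 0\<close>.\<close>

lemma containers_density:
  assumes "containers n a u" "i \<in> {1..n}"
  shows "u i * (a i / u i) = a i"
  using containers_D[OF assms] by auto

text \<open>The comparison is dropped only after an empty first container. Starting from a nonempty
  one, every index before \<open>i'\<close> on the way is nonempty, so the steps chain.\<close>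

lemma containers_antimono:
  assumes c: "containers n a u" and "1 \<le> i" "i \<le> i'" "i' \<le> n" and "0 < u i"
  shows "a i' / u i' \<le> a i / u i"
  using \<open>i \<le> i'\<close> \<open>i' \<le> n\<close>
proof (induction i' rule: dec_induct)
  case (step m)
  have "u m \<noteq> 0"
    using containers_D(2)[OF c, of m] \<open>1 \<le> i\<close> \<open>0 < u i\<close> step by (cases "m = i") auto
  then have "a (Suc m) / u (Suc m) \<le> a m / u m"
    using c step \<open>1 \<le> i\<close> by (simp add: containers_def)
  then show ?case using step by simp
qed simp

lemma cumulative_Suc: "cumulative w (Suc m) = cumulative w m + w (Suc m)"
  by (simp add: cumulative_def)

lemma cumulative_mono:
  assumes "\<And>i. i \<in> {1..n} \<Longrightarrow> 0 \<le> w i" "l \<le> m" "m \<le> n"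
  shows "cumulative w l \<le> cumulative w m"
  unfolding cumulative_def using assms by (intro sum_mono2) auto

text \<open>The sum telescopes: \<open>frac_mu u v i l\<close> is the increment of
  \<open>min (cumulative u i) (cumulative v l)\<close> from \<open>i - 1\<close> to
  \<open>i\<close>.\<close>

lemma sum_frac_mu:
  assumes "\<And>i. i \<in> {1..n} \<Longrightarrow> 0 \<le> u i" "0 \<le> cumulative v l" "m \<le> n"
  shows "(\<Sum>i=1..m. frac_mu u v i l) = min (cumulative u m) (cumulative v l)"
  using assms(3)
proof (induction m)
  case 0
  then show ?case using assms(2) by (simp add: cumulative_def)
next
  case (Suc m)
  then show ?case using assms(1)[of "Suc m"] by (auto simp: frac_mu_def cumulative_Suc)
qed

lemma frac_mu_bounds:
  assumes "0 \<le> u i"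
  shows "0 \<le> frac_mu u v i l" "frac_mu u v i l \<le> u i"
  using assms by (auto simp: frac_mu_def)

text \<open>Exchange argument: let \<open>m\<close> be the source in which the greedy draw ends. It
  takes everything before \<open>m\<close> and nothing after, so replacing each density by that of
  \<open>m\<close> can only lower the terms \<open>a i / u i * (frac_mu u v i l - z i)\<close>. At
  constant density they cancel, as both draws have equal volume.\<close>

lemma greedy_maximal:
  assumes c: "containers n a u" and V: "0 \<le> cumulative v l" "cumulative v l \<le> cumulative u n"
    and z: "\<And>i. i \<in> {1..n} \<Longrightarrow> 0 \<le> z i" "\<And>i. i \<in> {1..n} \<Longrightarrow> z i \<le> u i"
    and sum_z: "(\<Sum>i=1..n. z i) = cumulative v l"
  shows "(\<Sum>i=1..n. a i / u i * z i) \<le> (\<Sum>i=1..n. a i / u i * frac_mu u v i l)"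
proof -
  note u = containers_nonneg(1)[OF c]
  define m where "m = (LEAST m. cumulative v l \<le> cumulative u m)"
  have m: "cumulative v l \<le> cumulative u m" "m \<le> n"
    unfolding m_def using V by (auto intro: LeastI Least_le)
  have below: "cumulative u i < cumulative v l" if "i < m" for i
    using that not_less_Least unfolding m_def by force
  show ?thesis
  proof (cases "m = 0")
    \<comment> \<open>Now \<open>cumulative v l = 0\<close>: nothing is drawn, and \<open>m\<close>
      is not the index of a source.\<close>
    case True
    then have "(\<Sum>i=1..n. z i) = 0" using m V sum_z by (simp add: cumulative_def)
    then have "z i = 0" if "i \<in> {1..n}" for i
      using that z by (subst (asm) sum_nonneg_eq_0_iff) auto
    then have "(\<Sum>i=1..n. a i / u i * z i) = 0" by simp
    also have "0 \<le> (\<Sum>i=1..n. a i / u i * frac_mu u v i l)"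
      using containers_nonneg[OF c] frac_mu_bounds by (intro sum_nonneg) auto
    finally show ?thesis .
  next
    case False
    then obtain m' where m': "m = Suc m'" by (cases m) auto
    \<comment> \<open>Minimality of \<open>m\<close> makes the cumulative volume jump at
      \<open>m\<close>. Nonemptiness allows the comparison with the later sources.\<close>
    then have "0 < u m" using m(1) below[of m'] by (simp add: cumulative_Suc)
    have "a m / u m * (frac_mu u v i l - z i) \<le> a i / u i * (frac_mu u v i l - z i)"
      if i: "i \<in> {1..n}" for i
    proof -
      consider "i < m" "u i = 0" | "i < m" "0 < u i" | "i = m" | "m < i"
        using u[OF i] by force
      then show ?thesis
      proof cases
        case 1
        then show ?thesis using z[OF i] by (simp add: frac_mu_def)
      next
        case 2
        obtain i' where i': "i = Suc i'" using i by (cases i) auto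
        have "frac_mu u v i l = u i"
          using below[OF \<open>i < m\<close>] 2 i' by (simp add: frac_mu_def cumulative_Suc)
        moreover have "a m / u m \<le> a i / u i"
          using containers_antimono[OF c _ _ m(2)] 2 i by simp
        ultimately show ?thesis using z[OF i] by (intro mult_right_mono) auto
      next
        case 4
        then have "cumulative v l \<le> cumulative u (i - 1)"
          using m(1) cumulative_mono[of n u m "i - 1"] u i by force
        then have "frac_mu u v i l = 0" using u[OF i] by (simp add: frac_mu_def)
        moreover have "a i / u i \<le> a m / u m"
          using containers_antimono[OF c, of m i] 4 i m' \<open>0 < u m\<close> by simp
        ultimately show ?thesis using z[OF i] by (intro mult_right_mono_neg) auto
      qed simp
    qed
    then have "(\<Sum>i=1..n. a m / u m * (frac_mu u v i l - z i))
        \<le> (\<Sum>i=1..n. a i / u i * (frac_mu u v i l - z i))"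
      by (rule sum_mono)
    moreover have "(\<Sum>i=1..n. a m / u m * (frac_mu u v i l - z i)) = 0"
      using sum_frac_mu[OF u V(1) order_refl] sum_z V(2)
      by (simp add: sum_subtractf flip: sum_distrib_left sum_divide_distrib)
    ultimately show ?thesis
      by (simp add: right_diff_distrib sum_subtractf)
  qed
qed

section \<open>Slack condition, convex order and solvability\<close>

text \<open>Only targets denser than \<open>t\<close> contribute to the target potential. By the
  density order they form a prefix, apart from an empty container, whose terms are 0. The slack at
  its end \<open>l\<close> bounds their solute by that of the greedy draw, and any draw within
  \<open>u\<close> has excess over \<open>t\<close> at most the source potential.\<close>

lemma slack_condition_imp_convex_order:
  assumes cu: "containers n a u" and cv: "containers k b v"
    and vol: "(\<Sum>i=1..n. u i) = (\<Sum>j=1..k. v j)"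
    and mass: "(\<Sum>i=1..n. a i) = (\<Sum>j=1..k. b j)"
    and slack: "fractional_slack_condition n k a u b v"
  shows "potential {1..k} v (\<lambda>j. b j / v j) t \<le> potential {1..n} u (\<lambda>i. a i / u i) t"
proof -
  note u = containers_nonneg(1)[OF cu] and v = containers_nonneg(1)[OF cv]
  have eqU: "cumulative u n = cumulative v k" using vol by (simp add: cumulative_def)
  define S where "S = {j\<in>{1..k}. 0 < v j \<and> t < b j / v j}"
  show ?thesis
  proof (cases "S = {}")
    case True
    have "potential {1..k} v (\<lambda>j. b j / v j) t = 0"
      unfolding potential_def
    proof (intro sum.neutral ballI)
      fix j assume "j \<in> {1..k}"
      then show "v j * max 0 (b j / v j - t) = 0"
        using True v[of j] by (cases "v j = 0") (force simp: S_def max_def)+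
    qed
    also have "\<dots> \<le> potential {1..n} u (\<lambda>i. a i / u i) t"
      by (rule potential_nonneg) (rule u)
    finally show ?thesis .
  next
    case False
    define l where "l = Max S"
    have "finite S" by (simp add: S_def)
    then have "l \<in> S" and lmax: "\<And>j. j \<in> S \<Longrightarrow> j \<le> l" using False by (auto simp: l_def)
    then have l: "1 \<le> l" "l \<le> k" "0 < v l" "t < b l / v l" by (auto simp: S_def)
    have V: "0 \<le> cumulative v l" "cumulative v l \<le> cumulative u n"
      using cumulative_mono[of k v 0 l] cumulative_mono[of k v l k] v l eqU
      by (auto simp: cumulative_def)
    have "v j * max 0 (b j / v j - t) = (if j \<le> l then b j - t * v j else 0)"
      if j: "j \<in> {1..k}" for j
    proof (cases "v j = 0")
      case True
      then show ?thesis using containers_density[OF cv j] by simp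
    next
      case False
      then have "0 < v j" using v[OF j] by simp
      show ?thesis
      proof (cases "j \<le> l")
        case True
        then have "t < b j / v j"
          using containers_antimono[OF cv _ True l(2) \<open>0 < v j\<close>] l j by simp
        then show ?thesis
          using True containers_density[OF cv j] by (simp add: right_diff_distrib mult.commute)
      next
        case False
        then have "b j / v j \<le> t" using lmax[of j] j \<open>0 < v j\<close> by (force simp: S_def)
        then show ?thesis using False by simp
      qed
    qed
    then have "potential {1..k} v (\<lambda>j. b j / v j) t
        = (\<Sum>j=1..k. if j \<le> l then b j - t * v j else 0)"
      unfolding potential_def by (rule sum.cong[OF refl])
    also have "\<dots> = (\<Sum>j=1..l. b j - t * v j)"
      using l by (intro sum.mono_neutral_cong_right) auto
    also have "\<dots> = (\<Sum>j=1..l. b j) - t * cumulative v l"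
      by (simp add: cumulative_def sum_subtractf sum_distrib_left)
    also have "\<dots> \<le> (\<Sum>i=1..n. a i / u i * frac_mu u v i l) - t * cumulative v l"
    \<comment> \<open>The slack condition stops at \<open>k - 1\<close>. For \<open>l = k\<close>
      the greedy draw empties all sources, and equality of the total amounts takes its
      place.\<close>
    proof (cases "l = k")
      case True
      have "a i / u i * frac_mu u v i l = a i" if i: "i \<in> {1..n}" for i
      proof -
        obtain i' where i': "i = Suc i'" using i by (cases i) auto
        have "cumulative u i \<le> cumulative v l"
          using cumulative_mono[of n u i n] u i eqU True by simp
        then have "frac_mu u v i l = u i"
          using u[OF i] i' by (simp add: frac_mu_def cumulative_Suc)
        then show ?thesis using containers_density[OF cu i] by (simp add: mult.commute)
      qed
      then show ?thesis using mass True by simp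
    next
      case False
      then show ?thesis
        using slack l by (simp add: fractional_slack_condition_def slack_def)
    qed
    also have "\<dots> = (\<Sum>i=1..n. frac_mu u v i l * (a i / u i - t))"
      using sum_frac_mu[OF u V(1) order_refl] V(2)
      by (simp add: right_diff_distrib sum_subtractf mult.commute flip: sum_distrib_left)
    also have "\<dots> \<le> potential {1..n} u (\<lambda>i. a i / u i) t"
      unfolding potential_def
    proof (rule sum_mono)
      fix i assume i: "i \<in> {1..n}"
      have "frac_mu u v i l * (a i / u i - t) \<le> frac_mu u v i l * max 0 (a i / u i - t)"
        using frac_mu_bounds(1)[of u i v l] u[OF i] by (intro mult_left_mono) auto
      also have "\<dots> \<le> u i * max 0 (a i / u i - t)"
        using frac_mu_bounds(2)[of u i v l] u[OF i] by (intro mult_right_mono) auto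
      finally show "frac_mu u v i l * (a i / u i - t) \<le> u i * max 0 (a i / u i - t)" .
    qed
    finally show ?thesis .
  qed
qed

text \<open>A solution fills the first \<open>l\<close> targets by a draw \<open>z\<close> of volume
  \<open>cumulative v l\<close> whose solute is exactly their demand; the greedy draw holds at least
  as much.\<close>

lemma solvable_imp_slack_nonneg:
  assumes inst: "mixing_instance n k a u b v" and "mixing_solvable n k a u b v" and l: "l \<le> k"
  shows "0 \<le> slack n a u b v l"
proof -
  have cu: "containers n a u" and cv: "containers k b v"
    and vol: "cumulative u n = cumulative v k"
    using inst by (auto simp: mixing_instance_def cumulative_def)
  note u = containers_nonneg(1)[OF cu] and v = containers_nonneg(1)[OF cv]
  obtain x where x: "\<And>i j. i \<in> {1..n} \<Longrightarrow> j \<in> {1..k} \<Longrightarrow> 0 \<le> x i j"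
    "\<And>i. i \<in> {1..n} \<Longrightarrow> (\<Sum>j=1..k. x i j) = 1"
    "\<And>j. j \<in> {1..k} \<Longrightarrow> (\<Sum>i=1..n. u i * x i j) = v j"
    "\<And>j. j \<in> {1..k} \<Longrightarrow> (\<Sum>i=1..n. a i * x i j) = b j"
    using assms(2) unfolding mixing_solvable_def by blast
  define z where "z = (\<lambda>i. u i * (\<Sum>j=1..l. x i j))"
  have partial: "0 \<le> (\<Sum>j=1..l. x i j)" "(\<Sum>j=1..l. x i j) \<le> 1" if "i \<in> {1..n}" for i
  proof -
    show "0 \<le> (\<Sum>j=1..l. x i j)" using x(1) that l by (intro sum_nonneg) auto
    have "(\<Sum>j=1..l. x i j) \<le> (\<Sum>j=1..k. x i j)"
      using x(1) that l by (intro sum_mono2) auto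
    then show "(\<Sum>j=1..l. x i j) \<le> 1" using x(2) that by simp
  qed
  have "(\<Sum>i=1..n. a i / u i * z i) = (\<Sum>i=1..n. \<Sum>j=1..l. a i * x i j)"
  proof (rule sum.cong[OF refl])
    fix i assume i: "i \<in> {1..n}"
    have "a i / u i * z i = (u i * (a i / u i)) * (\<Sum>j=1..l. x i j)" by (simp add: z_def)
    also have "\<dots> = a i * (\<Sum>j=1..l. x i j)" by (simp only: containers_density[OF cu i])
    finally show "a i / u i * z i = (\<Sum>j=1..l. a i * x i j)" by (simp add: sum_distrib_left)
  qed
  also have "\<dots> = (\<Sum>j=1..l. b j)"
    using x(4) l by (subst sum.swap) (auto intro!: sum.cong)
  finally have eq: "(\<Sum>i=1..n. a i / u i * z i) = (\<Sum>j=1..l. b j)" .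
  have "(\<Sum>i=1..n. z i) = (\<Sum>i=1..n. \<Sum>j=1..l. u i * x i j)"
    by (simp add: z_def sum_distrib_left)
  also have "\<dots> = cumulative v l"
    unfolding cumulative_def using x(3) l by (subst sum.swap) (auto intro!: sum.cong)
  finally have "(\<Sum>i=1..n. z i) = cumulative v l" .
  moreover have "0 \<le> cumulative v l" "cumulative v l \<le> cumulative u n"
    using cumulative_mono[of k v 0 l] cumulative_mono[of k v l k] v l vol
    by (auto simp: cumulative_def)
  moreover have "0 \<le> z i" "z i \<le> u i" if "i \<in> {1..n}" for i
    using u[OF that] partial[OF that] by (auto simp: z_def mult_left_le)
  ultimately show ?thesis
    using greedy_maximal[OF cu, of v l z] eq by (simp add: slack_def)
qed

text \<open>The transport theorem yields absolute volumes \<open>y\<close>; dividing by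
  \<open>u i\<close> turns them into the fractions \<open>x\<close> of each source.\<close>

lemma slack_condition_imp_solvable:
  assumes inst: "mixing_instance n k a u b v" and "fractional_slack_condition n k a u b v"
  shows "mixing_solvable n k a u b v"
proof -
  have cu: "containers n a u" and cv: "containers k b v" and k: "1 \<le> k"
    and vol: "(\<Sum>i=1..n. u i) = (\<Sum>j=1..k. v j)" and mass: "(\<Sum>i=1..n. a i) = (\<Sum>j=1..k. b j)"
    using inst by (auto simp: mixing_instance_def)
  note u = containers_nonneg(1)[OF cu] and v = containers_nonneg(1)[OF cv]
  have "(\<Sum>i=1..n. u i * (a i / u i)) = (\<Sum>i=1..n. a i)"
    "(\<Sum>j=1..k. v j * (b j / v j)) = (\<Sum>j=1..k. b j)"
    using containers_density[OF cu] containers_density[OF cv] by (simp_all only: cong: sum.cong)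
  then have mass': "(\<Sum>i=1..n. u i * (a i / u i)) = (\<Sum>j=1..k. v j * (b j / v j))"
    using mass by (simp only:)
  have "\<exists>y. (\<forall>i\<in>{1..n}. \<forall>j\<in>{1..k}. 0 \<le> y i j) \<and> (\<forall>i\<in>{1..n}. (\<Sum>j=1..k. y i j) = u i) \<and>
    (\<forall>j\<in>{1..k}. (\<Sum>i=1..n. y i j) = v j) \<and>
    (\<forall>j\<in>{1..k}. (\<Sum>i=1..n. y i j * (a i / u i)) = v j * (b j / v j))"
    by (rule convex_order_transport[OF _ _ u v vol mass'
        slack_condition_imp_convex_order[OF cu cv vol mass assms(2)]]) auto
  then obtain y where y: "\<And>i j. i \<in> {1..n} \<Longrightarrow> j \<in> {1..k} \<Longrightarrow> 0 \<le> y i j"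
    "\<And>i. i \<in> {1..n} \<Longrightarrow> (\<Sum>j=1..k. y i j) = u i"
    "\<And>j. j \<in> {1..k} \<Longrightarrow> (\<Sum>i=1..n. y i j) = v j"
    "\<And>j. j \<in> {1..k} \<Longrightarrow> (\<Sum>i=1..n. y i j * (a i / u i)) = v j * (b j / v j)"
    by blast
  \<comment> \<open>The row of an empty source is unconstrained apart from its sum.\<close>
  define x where "x = (\<lambda>i j. if u i = 0 then (if j = 1 then 1 else 0) else y i j / u i)"
  have ux: "u i * x i j = y i j" if "i \<in> {1..n}" "j \<in> {1..k}" for i j
  proof (cases "u i = 0")
    case True
    then have "y i j = 0" using y(1,2) that by (metis finite_atLeastAtMost sum_nonneg_eq_0_iff)
    then show ?thesis using True by simp
  qed (simp add: x_def)
  have ax: "a i * x i j = y i j * (a i / u i)" if "i \<in> {1..n}" "j \<in> {1..k}" for i j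
  proof -
    have "a i * x i j = (u i * (a i / u i)) * x i j"
      by (simp only: containers_density[OF cu that(1)])
    also have "\<dots> = (u i * x i j) * (a i / u i)" by simp
    finally show ?thesis by (simp only: ux[OF that])
  qed
  have "0 \<le> x i j" if "i \<in> {1..n}" "j \<in> {1..k}" for i j
    using y(1)[OF that] u[OF that(1)] by (simp add: x_def)
  moreover have "(\<Sum>j=1..k. x i j) = 1" if "i \<in> {1..n}" for i
    using y(2)[OF that] k by (cases "u i = 0") (simp_all add: x_def flip: sum_divide_distrib)
  moreover have "(\<Sum>i=1..n. u i * x i j) = v j" if "j \<in> {1..k}" for j
    using ux y(3) that by simp
  moreover have "(\<Sum>i=1..n. a i * x i j) = b j" if "j \<in> {1..k}" for j
    using ax y(4)[OF that] containers_density[OF cv that] that by (simp only: cong: sum.cong)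
  ultimately show ?thesis unfolding mixing_solvable_def by blast
qed

theorem theorem1p12:
  fixes n k :: nat and a u b v :: "nat \<Rightarrow> real"
  assumes "mixing_instance n k a u b v"
  shows "mixing_solvable n k a u b v \<longleftrightarrow> fractional_slack_condition n k a u b v"
  using assms solvable_imp_slack_nonneg slack_condition_imp_solvable
  by (auto simp: fractional_slack_condition_def)

end
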